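(* Let $n,r,t,c$ be positive integers with $n\ge r\ge 2$ and $t\ge c\ge 1$. Let $a(r,c)=\left(r^r+1-\frac1r\right)(c-1)$. Let $T$ be a tight $r$-tree with $t$ edges and $c(T)\le c$. Then $$\mathrm{ex}_r(n,T)\le\left(\frac{t-1}{r}+a(r,c)\right)\binom{n}{r-1}.$$
   Context: An $r$-graph is a (finite) $r$-uniform hypergraph. An $r$-graph $T$ is a tight $r$-tree if its edges can be ordered as $e_1,\dots,e_t$ so that: ( * ) for each $i\ge 2$ there are a vertex $v\in e_i$ and an index $1\le s\le i-1$ such that $v\notin\bigcup_{j=1}^{i-1}e_j$ and $e_i\setminus\{v\}\subset e_s$. The vertex set of a tight tree is the union of its edges. Given a tight $r$-tree $T$ and a tight subtree $T'$ of $T$ (a subgraph of $T$ that is itself a tight $r$-tree), $T'$ is a trunk of $T$ if there is an ordering of the edges of $T$ satisfying ( * ) in which the edges of $T'$ are listed first, and for each $e\in E(T)\setminus E(T')$ there exists $e'\in E(T')$ with $|e\cap e'|=r-1$. $c(T)$ denotes the minimum number of edges in a trunk of $T$. An $r$-graph $G$ contains $H$ if there is an injection $V(H)\to V(G)$ mapping every edge of $H$ to an edge of $G$. $\mathrm{ex}_r(n,H)$ is the largest $m$ such that there exists an $n$-vertex $r$-graph with $m$ edges that does not contain $H$. *)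

theory Defs
  imports Complex_Main
begin

datatype 'a hypergraph = Hypergraph (verts: "'a set") (edges: "'a set set")

definition r_graph :: "nat \<Rightarrow> 'a hypergraph \<Rightarrow> bool" where
  "r_graph r G \<longleftrightarrow> finite (verts G) \<and> (\<forall>e\<in>edges G. e \<subseteq> verts G \<and> card e = r)"

definition subgraph :: "'a hypergraph \<Rightarrow> 'a hypergraph \<Rightarrow> bool" where
  "subgraph H G \<longleftrightarrow> verts H \<subseteq> verts G \<and> edges H \<subseteq> edges G"

definition contains_copy :: "'a hypergraph \<Rightarrow> 'b hypergraph \<Rightarrow> bool" where
  "contains_copy G H \<longleftrightarrow>
     (\<exists>f. inj_on f (verts H) \<and> f ` verts H \<subseteq> verts G \<and> (\<forall>e\<in>edges H. f ` e \<in> edges G))"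

(* The defining condition of a tight r-tree for a list of edges; positions are counted from 0. *)
definition tight_ordering :: "'a set list \<Rightarrow> bool" where
  "tight_ordering es \<longleftrightarrow>
     distinct es \<and>
     (\<forall>i\<in>{1..<length es}. \<exists>v\<in>es ! i. \<exists>s<i.
        v \<notin> (\<Union>j<i. es ! j) \<and> es ! i - {v} \<subseteq> es ! s)"

definition tight_tree :: "nat \<Rightarrow> 'a hypergraph \<Rightarrow> bool" where
  "tight_tree r T \<longleftrightarrow>
     r_graph r T \<and> verts T = \<Union>(edges T) \<and>
     (\<exists>es. es \<noteq> [] \<and> set es = edges T \<and> tight_ordering es)"

definition trunk :: "nat \<Rightarrow> 'a hypergraph \<Rightarrow> 'a hypergraph \<Rightarrow> bool" where
  "trunk r T' T \<longleftrightarrow>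
     tight_tree r T' \<and> subgraph T' T \<and>
     (\<exists>es fs. set es = edges T' \<and> set (es @ fs) = edges T \<and> tight_ordering (es @ fs)) \<and>
     (\<forall>e\<in>edges T - edges T'. \<exists>e'\<in>edges T'. card (e \<inter> e') = r - 1)"

(* Meaningful for a tight r-tree T; the minimum then exists, since T is a trunk of itself. *)
definition min_trunk_size :: "nat \<Rightarrow> 'a hypergraph \<Rightarrow> nat" where
  "min_trunk_size r T = (LEAST k. \<exists>T'. trunk r T' T \<and> card (edges T') = k)"

(* Host graphs have vertices in nat, which covers all finite hypergraphs up to isomorphism.
   The set of edge numbers is always finite; it is nonempty as soon as H has an edge, since
   the edgeless graph on n vertices does not contain such an H. *)
definition ex_num :: "nat \<Rightarrow> nat \<Rightarrow> 'a hypergraph \<Rightarrow> nat" where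
  "ex_num r n H =
     Max {card (edges G) | G :: nat hypergraph.
            r_graph r G \<and> card (verts G) = n \<and> \<not> contains_copy G H}"

definition a_const :: "nat \<Rightarrow> nat \<Rightarrow> real" where
  "a_const r c = (real r ^ r + 1 - 1 / real r) * (real c - 1)"

end

theory Submission
  imports Defs "HOL-Library.FuncSet"
begin

text \<open>
  Replace \<open>c\<close> by the number of edges of a smallest trunk, and let \<open>b = (t - c) / r + c - 1\<close>.
  The reciprocals of the codegrees of the \<open>(r - 1)\<close>-subsets of an edge, summed over all edges, give the size of the shadow; hence at most \<open>b\<close> times that many edges
  are bad, where an edge is good if \<open>b\<close> times its own sum of reciprocals is below 1. In a good edge
  the \<open>i\<close>-th smallest codegree exceeds \<open>i b\<close>. A random map from the vertices to the ranks
  \<open>1, \<dots>, r\<close> agrees with this ranking on a fraction \<open>1 / r^r\<close> of the good edges, which leaves more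
  than \<open>c - 1\<close> times the size of the shadow, so there is an \<open>r\<close>-partite subgraph with positive
  codegrees at least \<open>c\<close>. Properly colour the tree with \<open>1, \<dots>, r\<close> so that the number of pendant
  vertices outside the trunk increases with the colour. The trunk embeds greedily, respecting
  colours; then the pendant vertices are placed greedily in the order of their colours. At colour
  \<open>i\<close> at most \<open>i (t - c) / r\<close> pendant vertices and \<open>c\<close> trunk vertices compete for more than
  \<open>i b\<close> places.
\<close>

section \<open>Shadows, links and codegrees\<close>

definition shadow :: "'a set set \<Rightarrow> 'a set set" where
  "shadow E = {e - {v} | e v. e \<in> E \<and> v \<in> e}"

text \<open>The map \<open>v \<mapsto> insert v f\<close> is injective on this set, so its
  cardinality is the codegree of \<open>f\<close>.\<close>

definition link :: "'a set set \<Rightarrow> 'a set \<Rightarrow> 'a set" where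
  "link E f = {v. v \<notin> f \<and> insert v f \<in> E}"

lemma finite_link:
  assumes "finite E" "\<forall>e\<in>E. finite e"
  shows "finite (link E f)"
proof -
  have "link E f \<subseteq> \<Union>E" by (auto simp: link_def)
  then show ?thesis using assms by (meson finite_Union finite_subset)
qed

lemma finite_shadow:
  assumes "finite E" "\<forall>e\<in>E. finite e"
  shows "finite (shadow E)"
proof -
  have "shadow E = (\<Union>e\<in>E. \<Union>v\<in>e. {e - {v}})" by (auto simp: shadow_def)
  then show ?thesis using assms by auto
qed

lemma link_nonempty:
  assumes "f \<in> shadow E"
  shows "link E f \<noteq> {}"
proof -
  obtain e v where "e \<in> E" "v \<in> e" "f = e - {v}" using assms by (auto simp: shadow_def)
  then have "v \<in> link E f" by (simp add: link_def insert_absorb)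
  then show ?thesis by blast
qed

lemma shadow_mono: "E \<subseteq> E' \<Longrightarrow> shadow E \<subseteq> shadow E'"
  by (auto simp: shadow_def)

text \<open>Double counting: pairs of an edge and one of its vertices correspond to pairs of a
  shadow set \<open>f\<close> and a vertex of its link. Grouped by \<open>f\<close>, the reciprocal
  of the codegree is added as often as the codegree says, so each \<open>f\<close> contributes
  1.\<close>

lemma sum_inverse_codegree:
  assumes "finite E" "\<forall>e\<in>E. finite e"
  shows "(\<Sum>e\<in>E. \<Sum>v\<in>e. 1 / real (card (link E (e - {v})))) = real (card (shadow E))"
proof -
  have "(\<Sum>e\<in>E. \<Sum>v\<in>e. 1 / real (card (link E (e - {v}))))
      = (\<Sum>(e, v)\<in>Sigma E (\<lambda>e. e). 1 / real (card (link E (e - {v}))))"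
    using assms by (subst sum.Sigma) auto
  also have "\<dots> = (\<Sum>(f, v)\<in>Sigma (shadow E) (link E). 1 / real (card (link E f)))"
    by (rule sum.reindex_bij_witness[where j = "\<lambda>(e, v). (e - {v}, v)" and i = "\<lambda>(f, v). (insert v f, v)"])
       (auto simp: shadow_def link_def insert_absorb)
  also have "\<dots> = (\<Sum>f\<in>shadow E. \<Sum>v\<in>link E f. 1 / real (card (link E f)))"
    using finite_shadow[OF assms] finite_link[OF assms] by (subst sum.Sigma) auto
  also have "\<dots> = (\<Sum>f\<in>shadow E. 1)"
  proof (rule sum.cong[OF refl])
    fix f assume "f \<in> shadow E"
    then have "link E f \<noteq> {}" by (rule link_nonempty)
    then show "(\<Sum>v\<in>link E f. 1 / real (card (link E f))) = 1"
      using finite_link[OF assms, of f] by simp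
  qed
  finally show ?thesis by simp
qed

section \<open>Ranking, sorting and greedy selection\<close>

lemma ex_maximizer:
  fixes f :: "'a \<Rightarrow> 'b::linorder"
  assumes "finite A" "A \<noteq> {}"
  shows "\<exists>m\<in>A. \<forall>v\<in>A. f v \<le> f m"
proof -
  have "Max (f ` A) \<in> f ` A" using assms by auto
  then obtain m where "m \<in> A" "f m = Max (f ` A)" by (metis imageE)
  then show ?thesis using assms by (metis Max_ge finite_imageI imageI)
qed

text \<open>Label by increasing \<open>d\<close>. The \<open>i\<close>-th smallest value, counted
  from 1, has \<open>i\<close> reciprocals at least as large as its own, so \<open>i / d v\<close>
  is at most the whole sum. The induction removes a maximum, which takes the last label. Labels
  start at 0, hence the \<open>+ 1\<close>.\<close>

lemma rank_labelling:
  fixes d :: "'a \<Rightarrow> real" and \<beta> :: real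
  assumes "finite A" "\<forall>v\<in>A. 0 < d v" "0 \<le> \<beta>" "\<beta> * (\<Sum>v\<in>A. 1 / d v) < 1"
  shows "\<exists>\<pi>. bij_betw \<pi> A {..<card A} \<and> (\<forall>v\<in>A. (real (\<pi> v) + 1) * \<beta> < d v)"
  using assms
proof (induction "card A" arbitrary: A)
  case 0
  then show ?case by (auto simp: bij_betw_def)
next
  case (Suc k)
  have ne: "A \<noteq> {}" using Suc.hyps by auto
  obtain m where m: "m \<in> A" "\<forall>v\<in>A. d v \<le> d m"
    using ex_maximizer[OF Suc.prems(1) ne] by blast
  let ?B = "A - {m}"
  have cB: "k = card ?B" using Suc.hyps(2) m(1) Suc.prems(1) by simp
  have "(\<Sum>v\<in>?B. 1 / d v) \<le> (\<Sum>v\<in>A. 1 / d v)"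
    using Suc.prems by (intro sum_mono2) (auto simp: less_imp_le)
  then have "\<beta> * (\<Sum>v\<in>?B. 1 / d v) < 1"
    using Suc.prems(3,4) by (meson le_less_trans mult_left_mono)
  then obtain \<pi> where \<pi>: "bij_betw \<pi> ?B {..<k}" "\<forall>v\<in>?B. (real (\<pi> v) + 1) * \<beta> < d v"
    using Suc.hyps(1)[OF cB] Suc.prems cB by auto
  have "real (card A) * (1 / d m) = (\<Sum>v\<in>A. 1 / d m)" by simp
  also have "\<dots> \<le> (\<Sum>v\<in>A. 1 / d v)"
    using m Suc.prems(2) by (intro sum_mono frac_le) auto
  finally have "\<beta> * (real (card A) * (1 / d m)) < 1"
    using Suc.prems(3,4) by (meson le_less_trans mult_left_mono)
  then have dm: "(real k + 1) * \<beta> < d m"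
    using m(1) Suc.prems(2) Suc.hyps(2)[symmetric] by (simp add: field_simps)
  let ?\<pi> = "\<pi>(m := k)"
  have "bij_betw ?\<pi> ?B {..<k}" using \<pi>(1) by (subst bij_betw_cong[of _ _ \<pi>]) auto
  then have "bij_betw ?\<pi> (?B \<union> {m}) ({..<k} \<union> {k})"
    by (rule bij_betw_combine) (auto simp: bij_betw_def)
  moreover have "?B \<union> {m} = A" "{..<k} \<union> {k} = {..<card A}"
    using m(1) Suc.hyps(2) by auto
  ultimately have "bij_betw ?\<pi> A {..<card A}" by simp
  moreover have "\<forall>v\<in>A. (real (?\<pi> v) + 1) * \<beta> < d v" using \<pi>(2) dm by auto
  ultimately show ?case by blast
qed

text \<open>With the weights in increasing order, the average of an initial segment is at most the
  overall average. The induction removes a largest weight.\<close>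

lemma sorted_relabelling:
  fixes a :: "'i \<Rightarrow> nat"
  assumes "finite I"
  shows "\<exists>\<sigma>. bij_betw \<sigma> I {..<card I} \<and>
    (\<forall>i\<in>I. card I * (\<Sum>j | j \<in> I \<and> \<sigma> j \<le> \<sigma> i. a j) \<le> (\<sigma> i + 1) * sum a I)"
  using assms
proof (induction "card I" arbitrary: I)
  case 0
  then show ?case by (auto simp: bij_betw_def)
next
  case (Suc k)
  have ne: "I \<noteq> {}" using Suc.hyps by auto
  obtain m where m: "m \<in> I" "\<forall>v\<in>I. a v \<le> a m"
    using ex_maximizer[OF Suc.prems(1) ne] by blast
  let ?J = "I - {m}"
  have cJ: "k = card ?J" using Suc.hyps(2) m(1) Suc.prems(1) by simp
  obtain \<sigma> where \<sigma>: "bij_betw \<sigma> ?J {..<k}"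
      "\<forall>i\<in>?J. k * (\<Sum>j | j \<in> ?J \<and> \<sigma> j \<le> \<sigma> i. a j) \<le> (\<sigma> i + 1) * sum a ?J"
    using Suc.hyps(1)[OF cJ] Suc.prems cJ by auto
  let ?\<sigma> = "\<sigma>(m := k)"
  have "bij_betw ?\<sigma> ?J {..<k}" using \<sigma>(1) by (subst bij_betw_cong[of _ _ \<sigma>]) auto
  then have "bij_betw ?\<sigma> (?J \<union> {m}) ({..<k} \<union> {k})"
    by (rule bij_betw_combine) (auto simp: bij_betw_def)
  moreover have "?J \<union> {m} = I" "{..<k} \<union> {k} = {..<card I}"
    using m(1) Suc.hyps(2) by auto
  ultimately have bij: "bij_betw ?\<sigma> I {..<card I}" by simp
  have lt: "\<sigma> i < k" if "i \<in> ?J" for i using \<sigma>(1) that by (auto simp: bij_betw_def)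
  have sI: "sum a I = a m + sum a ?J" using m(1) Suc.prems by (simp add: sum.remove)
  have "sum a ?J \<le> card ?J * a m" using m(2) sum_bounded_above[of ?J a "a m"] by auto
  \<comment> \<open>Removing the largest weight does not raise the average; the form without
    division stays in the natural numbers.\<close>
  then have avg: "Suc k * sum a ?J \<le> k * sum a I" using cJ sI by (simp add: algebra_simps)
  have "card I * (\<Sum>j | j \<in> I \<and> ?\<sigma> j \<le> ?\<sigma> i. a j) \<le> (?\<sigma> i + 1) * sum a I" if i: "i \<in> I" for i
  proof (cases "i = m")
    case True
    have "{j \<in> I. ?\<sigma> j \<le> ?\<sigma> i} = I" using True lt by (auto simp: less_imp_le)
    then show ?thesis using True Suc.hyps(2) by simp
  next
    case False
    then have iJ: "i \<in> ?J" using i by simp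
    let ?S = "\<Sum>j | j \<in> ?J \<and> \<sigma> j \<le> \<sigma> i. a j"
    have eq: "{j \<in> I. ?\<sigma> j \<le> ?\<sigma> i} = {j \<in> ?J. \<sigma> j \<le> \<sigma> i}" using False lt[OF iJ] by auto
    have "k * (Suc k * ?S) = Suc k * (k * ?S)" by (rule mult.left_commute)
    also have "\<dots> \<le> Suc k * ((\<sigma> i + 1) * sum a ?J)" using \<sigma>(2) iJ by (intro mult_left_mono) auto
    also have "\<dots> = (\<sigma> i + 1) * (Suc k * sum a ?J)" by (rule mult.left_commute)
    also have "\<dots> \<le> (\<sigma> i + 1) * (k * sum a I)" using avg by (rule mult_left_mono) simp
    also have "\<dots> = k * ((\<sigma> i + 1) * sum a I)" by (rule mult.left_commute)
    finally have "Suc k * ?S \<le> (\<sigma> i + 1) * sum a I" using lt[OF iJ] by (simp del: mult_Suc)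
    then show ?thesis using False eq Suc.hyps(2)[symmetric] by simp
  qed
  with bij show ?case by blast
qed

text \<open>Greedy choice by increasing key: the elements served before \<open>p\<close> have keys
  at most \<open>key p\<close>, so together with \<open>p\<close> they number at most
  \<open>card (N p)\<close> and a free value is left. The induction removes an element of largest
  key, which is served last.\<close>

lemma distinct_representatives_by_key:
  fixes key :: "'p \<Rightarrow> nat"
  assumes "finite P" "\<forall>p\<in>P. finite (N p) \<and> card {q \<in> P. key q \<le> key p} \<le> card (N p)"
  shows "\<exists>h. inj_on h P \<and> (\<forall>p\<in>P. h p \<in> N p)"
  using assms
proof (induction "card P" arbitrary: P)
  case 0
  then show ?case by auto
next
  case (Suc k)
  have ne: "P \<noteq> {}" using Suc.hyps by auto
  obtain m where m: "m \<in> P" "\<forall>v\<in>P. key v \<le> key m"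
    using ex_maximizer[OF Suc.prems(1) ne] by blast
  let ?Q = "P - {m}"
  have cQ: "k = card ?Q" using Suc.hyps(2) m(1) Suc.prems(1) by simp
  have "\<forall>p\<in>?Q. finite (N p) \<and> card {q \<in> ?Q. key q \<le> key p} \<le> card (N p)"
  proof
    fix p assume p: "p \<in> ?Q"
    have "card {q \<in> ?Q. key q \<le> key p} \<le> card {q \<in> P. key q \<le> key p}"
      using Suc.prems(1) by (intro card_mono) auto
    then show "finite (N p) \<and> card {q \<in> ?Q. key q \<le> key p} \<le> card (N p)"
      using Suc.prems(2) p by fastforce
  qed
  then obtain h where h: "inj_on h ?Q" "\<forall>p\<in>?Q. h p \<in> N p"
    using Suc.hyps(1)[OF cQ] Suc.prems(1) by auto
  have "{q \<in> P. key q \<le> key m} = P" using m(2) by auto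
  then have "Suc k \<le> card (N m)" using Suc.prems(2) m(1) Suc.hyps(2) by fastforce
  moreover have "card (h ` ?Q) \<le> k" using cQ Suc.prems(1) by (simp add: card_image_le)
  ultimately have "\<not> N m \<subseteq> h ` ?Q"
    using Suc.prems(1) by (metis card_mono finite_Diff finite_imageI not_less_eq_eq order_trans)
  then obtain w where w: "w \<in> N m" "w \<notin> h ` ?Q" by blast
  have "inj_on (h(m := w)) P" "\<forall>p\<in>P. (h(m := w)) p \<in> N p"
    using h w by (auto simp: inj_on_def)
  then show ?case by blast
qed

section \<open>Averaging over colourings and passing to large codegrees\<close>

text \<open>An edge receives its prescribed pattern under \<open>r ^ (card V - r)\<close> of the
  \<open>r ^ card V\<close> colourings, a fraction \<open>1 / r ^ r\<close>. Some colouring does at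
  least as well as the average.\<close>

lemma colouring_average:
  fixes H :: "'a set set" and \<pi> :: "'a set \<Rightarrow> 'a \<Rightarrow> nat"
  assumes "finite V" "\<forall>e\<in>H. e \<subseteq> V \<and> card e = r \<and> \<pi> e ` e \<subseteq> {..<r}"
  shows "\<exists>\<chi>. card H \<le> r ^ r * card {e \<in> H. \<forall>v\<in>e. \<chi> v = \<pi> e v}"
proof (cases "r = 0")
  case True
  \<comment> \<open>For \<open>r = 0\<close> all edges are empty, so any colouring agrees with all
    of them.\<close>
  have "{e \<in> H. \<forall>v\<in>e. undefined v = \<pi> e v} = H"
    using assms True by (auto dest: finite_subset)
  then show ?thesis using True by (intro exI[of _ undefined]) simp
next
  case False
  let ?C = "V \<rightarrow>\<^sub>E {..<r}"
  have finH: "finite H" using assms by (meson finite_Pow_iff finite_subset PowI subsetI)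
  have finC: "finite ?C" using assms(1) by (simp add: finite_PiE)
  have cardC: "card ?C = r ^ card V" using assms(1) by (simp add: card_PiE)
  have agree: "r ^ r * card {\<chi> \<in> ?C. \<forall>v\<in>e. \<chi> v = \<pi> e v} = r ^ card V" if e: "e \<in> H" for e
  proof -
    have eV: "e \<subseteq> V" "card e = r" using assms(2) e by auto
    \<comment> \<open>Agreement forces the colours on \<open>e\<close> and leaves the others free,
      so the agreeing colourings form a product set.\<close>
    have "{\<chi> \<in> ?C. \<forall>v\<in>e. \<chi> v = \<pi> e v} = Pi\<^sub>E V (\<lambda>v. if v \<in> e then {\<pi> e v} else {..<r})"
      using assms(2) e unfolding PiE_def Pi_def by (fastforce split: if_splits)
    then have "card {\<chi> \<in> ?C. \<forall>v\<in>e. \<chi> v = \<pi> e v}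
        = (\<Prod>v\<in>V. card (if v \<in> e then {\<pi> e v} else {..<r}))"
      using assms(1) by (simp add: card_PiE)
    also have "\<dots> = (\<Prod>v\<in>V. if v \<in> e then 1 else r)" by (rule prod.cong) auto
    also have "\<dots> = r ^ card (V - e)"
      using assms(1) by (simp add: prod.If_cases Diff_eq)
    finally have "r ^ r * card {\<chi> \<in> ?C. \<forall>v\<in>e. \<chi> v = \<pi> e v} = r ^ (r + card (V - e))"
      by (simp add: power_add)
    also have "r + card (V - e) = card V"
      using eV assms(1) by (metis card_Diff_subset card_mono finite_subset le_add_diff_inverse)
    finally show ?thesis .
  qed
  have "r ^ r * (\<Sum>\<chi>\<in>?C. card {e \<in> H. \<forall>v\<in>e. \<chi> v = \<pi> e v})
      = r ^ r * (\<Sum>e\<in>H. card {\<chi> \<in> ?C. \<forall>v\<in>e. \<chi> v = \<pi> e v})"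
    using sum_multicount_gen[OF finC finH, of "\<lambda>\<chi> e. \<forall>v\<in>e. \<chi> v = \<pi> e v"] by simp
  also have "\<dots> = (\<Sum>e\<in>H. r ^ card V)"
    using agree by (simp add: sum_distrib_left)
  also have "\<dots> = (\<Sum>\<chi>\<in>?C. card H)" using cardC by simp
  finally have *: "(\<Sum>\<chi>\<in>?C. r ^ r * card {e \<in> H. \<forall>v\<in>e. \<chi> v = \<pi> e v}) = (\<Sum>\<chi>\<in>?C. card H)"
    by (simp add: sum_distrib_left)
  have "?C \<noteq> {}" using cardC False by auto
  then show ?thesis using * sum_strict_mono[OF finC, of "\<lambda>\<chi>. r ^ r * card {e \<in> H. \<forall>v\<in>e. \<chi> v = \<pi> e v}" "\<lambda>_. card H"]
    by (metis (no_types, lifting) less_irrefl not_le_imp_less)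
qed

text \<open>While some shadow set has codegree at most \<open>k\<close>, delete the edges through
  it. This costs at most \<open>k\<close> edges and removes a set from the shadow, so the hypothesis
  persists, and it excludes that all edges disappear.\<close>

lemma min_codegree_subgraph:
  assumes "finite E" "\<forall>e\<in>E. finite e" "k * card (shadow E) < card E"
  shows "\<exists>E'\<subseteq>E. E' \<noteq> {} \<and> (\<forall>f\<in>shadow E'. k < card (link E' f))"
  using assms
proof (induction "card E" arbitrary: E rule: less_induct)
  case less
  show ?case
  proof (cases "\<forall>f\<in>shadow E. k < card (link E f)")
    case True
    moreover have "E \<noteq> {}" using less.prems(3) by auto
    ultimately show ?thesis by blast
  next
    case False
    then obtain f where f: "f \<in> shadow E" "card (link E f) \<le> k" by force
    let ?L = "(\<lambda>v. insert v f) ` link E f"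
    let ?E = "E - ?L"
    have finL: "finite (link E f)" using finite_link less.prems by blast
    have LE: "?L \<subseteq> E" by (auto simp: link_def)
    have cL: "card ?L \<le> k" using f(2) card_image_le[OF finL] order_trans by blast
    have Lne: "?L \<noteq> {}" using link_nonempty[OF f(1)] by simp
    have "f \<notin> shadow ?E"
    proof
      assume "f \<in> shadow ?E"
      then obtain e v where ev: "e \<in> ?E" "v \<in> e" "f = e - {v}" by (auto simp: shadow_def)
      then have "insert v f = e" "v \<notin> f" by auto
      then have "e \<in> ?L" using ev(1) by (auto simp: link_def)
      then show False using ev(1) by blast
    qed
    then have "shadow ?E \<subseteq> shadow E - {f}" using shadow_mono[of ?E E] by blast
    then have "card (shadow ?E) \<le> card (shadow E) - 1"
      using f(1) finite_shadow[OF less.prems(1,2)] by (metis card_Diff_singleton card_mono finite_Diff)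
    then have "k * card (shadow ?E) \<le> k * card (shadow E) - k"
      by (metis diff_mult_distrib2 mult.right_neutral mult_le_mono2)
    moreover have "card ?E = card E - card ?L"
      using LE less.prems(1) by (simp add: card_Diff_subset finite_subset)
    \<comment> \<open>The shadow contains \<open>f\<close>, so the truncated subtraction above is
      exact.\<close>
    moreover have "k \<le> k * card (shadow E)"
      using f(1) finite_shadow[OF less.prems(1,2)] by (cases "card (shadow E)") auto
    ultimately have "k * card (shadow ?E) < card ?E" using cL less.prems(3) by linarith
    moreover have "card ?E < card E" using LE Lne less.prems(1) by (intro psubset_card_mono) auto
    ultimately obtain E' where "E' \<subseteq> ?E" "E' \<noteq> {}" "\<forall>f\<in>shadow E'. k < card (link E' f)"
      using less.hyps[of ?E] less.prems by auto
    then show ?thesis by blast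
  qed
qed

section \<open>Structure of tight orderings\<close>

text \<open>Replaces the indices of the definition by the last edge and the set of earlier edges,
  the form that the inductions from the right end of the list need.\<close>

lemma tight_ordering_snocD:
  assumes "tight_ordering (es @ [e])"
  shows "tight_ordering es" "e \<notin> set es"
    "es \<noteq> [] \<Longrightarrow> \<exists>v\<in>e. v \<notin> \<Union>(set es) \<and> (\<exists>e'\<in>set es. e - {v} \<subseteq> e')"
proof -
  have D: "distinct (es @ [e])" and
    S: "\<And>i. i \<in> {1..<length (es @ [e])} \<Longrightarrow> \<exists>v\<in>(es @ [e]) ! i. \<exists>s<i.
        v \<notin> (\<Union>j<i. (es @ [e]) ! j) \<and> (es @ [e]) ! i - {v} \<subseteq> (es @ [e]) ! s"
    using assms unfolding tight_ordering_def by auto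
  show "e \<notin> set es" using D by simp
  have U: "(\<Union>j<i. (es @ [e]) ! j) = (\<Union>j<i. es ! j)" if "i \<le> length es" for i
    using that by (intro SUP_cong) (auto simp: nth_append)
  show "tight_ordering es"
    unfolding tight_ordering_def
  proof (intro conjI ballI)
    show "distinct es" using D by simp
    fix i assume i: "i \<in> {1..<length es}"
    then obtain v s where "v \<in> es ! i" "s < i" "v \<notin> (\<Union>j<i. es ! j)" "es ! i - {v} \<subseteq> es ! s"
      using S[of i] U[of i] by (auto simp: nth_append)
    then show "\<exists>v\<in>es ! i. \<exists>s<i. v \<notin> (\<Union>j<i. es ! j) \<and> es ! i - {v} \<subseteq> es ! s" by blast
  qed
  show "\<exists>v\<in>e. v \<notin> \<Union>(set es) \<and> (\<exists>e'\<in>set es. e - {v} \<subseteq> e')" if "es \<noteq> []"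
  proof -
    have "length es \<in> {1..<length (es @ [e])}" using that by (cases es) auto
    from S[OF this] U[of "length es"] obtain v s where
      "v \<in> e" "s < length es" "v \<notin> (\<Union>j<length es. es ! j)" "e - {v} \<subseteq> es ! s"
      by (auto simp: nth_append)
    moreover have "\<Union>(set es) = (\<Union>j<length es. es ! j)" by (auto simp: set_conv_nth)
    ultimately show ?thesis by (metis nth_mem)
  qed
qed

lemma tight_ordering_appendD: "tight_ordering (es @ fs) \<Longrightarrow> tight_ordering es"
proof (induction fs rule: rev_induct)
  case (snoc f fs)
  then show ?case using tight_ordering_snocD(1)[of "es @ fs" f] by simp
qed simp

text \<open>Take for \<open>\<nu> p\<close> the vertex that \<open>p\<close> introduces: it avoids
  all earlier edges, hence also their new vertices.\<close>

lemma tight_ordering_new_vertices: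
  assumes "tight_ordering (es @ fs)" "es \<noteq> []"
  shows "\<exists>\<nu>. inj_on \<nu> (set fs) \<and> (\<forall>p\<in>set fs. \<nu> p \<in> p \<and> \<nu> p \<notin> \<Union>(set es))"
  using assms
proof (induction fs rule: rev_induct)
  case (snoc f fs)
  have T: "tight_ordering ((es @ fs) @ [f])" using snoc.prems by simp
  obtain \<nu> where \<nu>: "inj_on \<nu> (set fs)" "\<forall>p\<in>set fs. \<nu> p \<in> p \<and> \<nu> p \<notin> \<Union>(set es)"
    using snoc.IH tight_ordering_snocD(1)[OF T] snoc.prems(2) by blast
  obtain v where v: "v \<in> f" "v \<notin> \<Union>(set (es @ fs))"
    using tight_ordering_snocD(3)[OF T] snoc.prems(2) by auto
  have fn: "f \<notin> set fs" using tight_ordering_snocD(2)[OF T] by simp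
  have "inj_on (\<nu>(f := v)) (set (fs @ [f]))"
    using \<nu> v fn unfolding inj_on_def by auto
  moreover have "\<forall>p\<in>set (fs @ [f]). (\<nu>(f := v)) p \<in> p \<and> (\<nu>(f := v)) p \<notin> \<Union>(set es)"
    using \<nu> v by auto
  ultimately show ?case by blast
qed simp

text \<open>The old vertices of a new edge lie in one earlier edge and so have \<open>r - 1\<close>
  distinct colours; the new vertex takes the missing one.\<close>

lemma tight_ordering_colouring:
  assumes "tight_ordering es" "\<forall>e\<in>set es. card e = r" "0 < r"
  shows "\<exists>\<kappa>. \<forall>e\<in>set es. bij_betw \<kappa> e {..<r}"
  using assms
proof (induction es rule: rev_induct)
  case (snoc e es)
  have fe: "finite e" "card e = r" using snoc.prems by (auto intro: card_ge_0_finite)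
  show ?case
  proof (cases "es = []")
    case True
    then show ?thesis using ex_bij_betw_finite_nat[OF fe(1)] fe(2) by (auto simp: atLeast0LessThan)
  next
    case False
    obtain \<kappa> where \<kappa>: "\<forall>e\<in>set es. bij_betw \<kappa> e {..<r}"
      using snoc tight_ordering_snocD(1) by (metis butlast_snoc in_set_butlastD)
    obtain v e' where v: "v \<in> e" "v \<notin> \<Union>(set es)" "e' \<in> set es" "e - {v} \<subseteq> e'"
      using tight_ordering_snocD(3)[OF snoc.prems(1) False] by blast
    have inj: "inj_on \<kappa> (e - {v})" and sub: "\<kappa> ` (e - {v}) \<subseteq> {..<r}"
      using \<kappa> v(3,4) by (auto simp: bij_betw_def intro: inj_on_subset)
    have "card (\<kappa> ` (e - {v})) = r - 1" using inj fe v(1) by (simp add: card_image)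
    then have "card ({..<r} - \<kappa> ` (e - {v})) = 1"
      using sub snoc.prems(3) fe by (simp add: card_Diff_subset)
    then obtain i where i: "{..<r} - \<kappa> ` (e - {v}) = {i}" by (auto simp: card_1_singleton_iff)
    let ?k = "\<kappa>(v := i)"
    have "bij_betw ?k (e - {v}) (\<kappa> ` (e - {v}))"
      using inj by (subst bij_betw_cong[of _ _ \<kappa>]) (auto simp: bij_betw_def)
    then have "bij_betw ?k ((e - {v}) \<union> {v}) (\<kappa> ` (e - {v}) \<union> {i})"
      using i by (intro bij_betw_combine) (auto simp: bij_betw_def)
    moreover have "(e - {v}) \<union> {v} = e" "\<kappa> ` (e - {v}) \<union> {i} = {..<r}" using v(1) i sub by auto
    ultimately have "bij_betw ?k e {..<r}" by simp
    moreover have "bij_betw ?k x {..<r}" if "x \<in> set es" for x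
      using \<kappa> that v(2) by (subst bij_betw_cong[of _ _ \<kappa>]) auto
    ultimately have "\<forall>x\<in>set (es @ [e]). bij_betw ?k x {..<r}" by simp
    then show ?thesis by blast
  qed
qed simp

text \<open>The first edge brings \<open>r\<close> vertices and every later edge one more.\<close>

lemma card_Union_tight_ordering:
  assumes "tight_ordering es" "\<forall>e\<in>set es. card e = r" "0 < r" "es \<noteq> []"
  shows "finite (\<Union>(set es)) \<and> card (\<Union>(set es)) + 1 \<le> length es + r"
  using assms
proof (induction es rule: rev_induct)
  case (snoc e es)
  have fe: "finite e" "card e = r" using snoc.prems by (auto intro: card_ge_0_finite)
  show ?case
  proof (cases "es = []")
    case True
    then show ?thesis using fe by simp
  next
    case False
    have IH: "finite (\<Union>(set es))" "card (\<Union>(set es)) + 1 \<le> length es + r"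
      using snoc False tight_ordering_snocD(1) by auto
    obtain v where "e - {v} \<subseteq> \<Union>(set es)" "v \<in> e"
      using tight_ordering_snocD(3)[OF snoc.prems(1) False] by blast
    then have "\<Union>(set (es @ [e])) = insert v (\<Union>(set es))" by auto
    then show ?thesis using IH card_insert_le_m1 by (auto simp: card_insert_if)
  qed
qed simp

section \<open>Greedy embedding of the trunk\<close>

text \<open>The old part of a new edge is mapped into the shadow of \<open>E\<close>, where the
  codegree exceeds the number of used vertices that could block. Colours are preserved
  automatically, as every edge of \<open>E\<close> has all \<open>r\<close> colours.\<close>

lemma coloured_trunk_embedding:
  fixes \<kappa> :: "'a \<Rightarrow> nat" and \<chi> :: "'b \<Rightarrow> nat"
  assumes "tight_ordering es" "\<forall>e\<in>set es. bij_betw \<kappa> e {..<r}" "0 < r" "es \<noteq> []"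
    and E: "finite E" "E \<noteq> {}" "\<forall>e\<in>E. bij_betw \<chi> e {..<r}"
    and deg: "\<forall>f\<in>shadow E. length es \<le> card (link E f)"
  shows "\<exists>g. inj_on g (\<Union>(set es)) \<and> (\<forall>e\<in>set es. g ` e \<in> E) \<and> (\<forall>x\<in>\<Union>(set es). \<chi> (g x) = \<kappa> x)"
  using assms(1-4) deg
proof (induction es rule: rev_induct)
  case (snoc e es)
  have be: "bij_betw \<kappa> e {..<r}" using snoc.prems by simp
  have crd: "\<forall>e\<in>set es. card e = r" using snoc.prems(2) bij_betw_same_card[of \<kappa> _ "{..<r}"] by fastforce
  have fe: "finite e" "card e = r" using be snoc.prems(3) by (auto dest: bij_betw_same_card bij_betw_finite)
  show ?case
  proof (cases "es = []")
    case True
    obtain a where a: "a \<in> E" using E(2) by auto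
    then have ba: "bij_betw \<chi> a {..<r}" using E by auto
    \<comment> \<open>The first edge goes to an arbitrary edge of \<open>E\<close>, matched by
      colours.\<close>
    let ?g = "\<lambda>x. inv_into a \<chi> (\<kappa> x)"
    have "bij_betw ?g e a"
      using bij_betw_trans[OF be bij_betw_inv_into[OF ba]] by (simp add: comp_def)
    moreover have "\<chi> (?g x) = \<kappa> x" if "x \<in> e" for x
      using be ba that by (metis bij_betwE bij_betw_inv_into_right)
    ultimately show ?thesis using a True by (intro exI[of _ ?g]) (auto simp: bij_betw_def)
  next
    case False
    obtain g where g: "inj_on g (\<Union>(set es))" "\<forall>e\<in>set es. g ` e \<in> E" "\<forall>x\<in>\<Union>(set es). \<chi> (g x) = \<kappa> x"
      using snoc False tight_ordering_snocD(1) by fastforce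
    obtain v e' where v: "v \<in> e" "v \<notin> \<Union>(set es)" "e' \<in> set es" "e - {v} \<subseteq> e'"
      using tight_ordering_snocD(3)[OF snoc.prems(1) False] by blast
    let ?U = "\<Union>(set es)" and ?f = "g ` (e - {v})"
    have U: "finite ?U" "card ?U + 1 \<le> length es + r"
      using card_Union_tight_ordering[OF tight_ordering_snocD(1)[OF snoc.prems(1)] crd snoc.prems(3) False] by auto
    have e'U: "e' \<subseteq> ?U" using v(3) by auto
    have fe': "finite e'" "card e' = r" using crd v(3) snoc.prems(3) by (auto intro: card_ge_0_finite)
    have "card (e' - (e - {v})) = 1"
      using v fe fe' snoc.prems(3) by (simp add: card_Diff_subset)
    then obtain x where x: "e' - (e - {v}) = {x}" by (auto simp: card_1_singleton_iff)
    have "?f = g ` e' - {g x}"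
    proof -
      have "e - {v} = e' - {x}" "x \<in> e'" using x v(4) by auto
      then show ?thesis using inj_on_image_set_diff[OF g(1), of e' "{x}"] e'U by auto
    qed
    moreover have "g x \<in> g ` e'" using x by auto
    ultimately have fs: "?f \<in> shadow E" using g(2) v(3) unfolding shadow_def by blast
    then have dg: "length es + 1 \<le> card (link E ?f)" using snoc.prems(5) by simp
    have injf: "inj_on g (e - {v})" using g(1) v(4) e'U by (meson inj_on_subset subset_trans)
    \<comment> \<open>Link vertices lie outside \<open>?f\<close>, so only used vertices outside
      \<open>?f\<close> can block. By the vertex count there are at most \<open>length es\<close> of
      them, against a codegree of at least \<open>length es + 1\<close>.\<close>
    have "card (g ` ?U - ?f) = card ?U - (r - 1)"
    proof -
      have "?f \<subseteq> g ` ?U" using v(4) e'U by auto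
      then show ?thesis using U fe v(1) g(1) injf by (simp add: card_Diff_subset card_image)
    qed
    then have "card (g ` ?U - ?f) < card (link E ?f)" using dg U snoc.prems(3) by linarith
    then have "\<not> link E ?f \<subseteq> g ` ?U - ?f" using U(1) by (metis card_mono finite_Diff finite_imageI not_le)
    then obtain w where w: "w \<in> link E ?f" "w \<notin> g ` ?U" by (auto simp: link_def)
    have wf: "w \<notin> ?f" "insert w ?f \<in> E" using w by (auto simp: link_def)
    have bw: "bij_betw \<chi> (insert w ?f) {..<r}" using E wf by blast
    have "\<chi> ` ?f = \<kappa> ` (e - {v})"
      unfolding image_image
    proof (rule image_cong[OF refl])
      fix x assume "x \<in> e - {v}"
      then show "\<chi> (g x) = \<kappa> x" using g(3) v(4) e'U by blast
    qed
    also have "\<dots> = {..<r} - {\<kappa> v}" using be v(1) by (auto simp: bij_betw_def inj_on_def)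
    \<comment> \<open>The set \<open>?f\<close> uses every colour except \<open>\<kappa> v\<close>,
      so this is the only colour left for \<open>w\<close>.\<close>
    finally have "{..<r} - {\<kappa> v} = \<chi> ` ?f" ..
    moreover have "\<chi> w \<in> {..<r}" "\<chi> w \<notin> \<chi> ` ?f"
      using bw wf(1) by (auto simp: bij_betw_def)
    ultimately have cw: "\<chi> w = \<kappa> v" by blast
    let ?g = "g(v := w)"
    have U': "\<Union>(set (es @ [e])) = insert v ?U" using v e'U by auto
    have "inj_on ?g (insert v ?U)" using g(1) v(2) w(2) by (auto simp: inj_on_def)
    moreover have "?g ` e = insert w ?f" using v(1) by auto
    moreover have "?g ` y = g ` y" if "y \<in> set es" for y using v(2) that by auto
    moreover have "\<forall>x\<in>insert v ?U. \<chi> (?g x) = \<kappa> x" using g(3) cw v(2) by auto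
    ultimately show ?thesis
      using g(2) wf(2) unfolding U' by (intro exI[of _ ?g] conjI) (simp_all del: fun_upd_apply)
  qed
qed simp

section \<open>A coloured subgraph of the host that respects codegree ranks\<close>

text \<open>Two codegrees occur: the bound \<open>k\<close> holds inside \<open>E'\<close>, where
  the trunk will be placed, while the rank inequality refers to all of \<open>E\<close>, where
  pendant edges may go. In \<open>big\<close>, the term \<open>\<beta>\<close> pays for the bad
  edges and \<open>r ^ r * k\<close> for the loss in the colouring average.\<close>

lemma rank_coloured_subgraph:
  fixes E :: "'a set set" and \<beta> :: real and k r :: nat
  assumes E: "finite E" "\<forall>e\<in>E. card e = r" and r: "0 < r" and "0 \<le> \<beta>"
    and big: "(\<beta> + real (r ^ r * k)) * real (card (shadow E)) < real (card E)"
  shows "\<exists>E' \<chi>. E' \<subseteq> E \<and> E' \<noteq> {} \<and> (\<forall>f\<in>shadow E'. k < card (link E' f)) \<and>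
    (\<forall>e\<in>E'. bij_betw \<chi> e {..<r} \<and>
      (\<forall>v\<in>e. (real (\<chi> v) + 1) * \<beta> < real (card (link E (e - {v})))))"
proof -
  have fin: "\<forall>e\<in>E. finite e" using E(2) r by (auto intro: card_ge_0_finite)
  let ?d = "\<lambda>e v. real (card (link E (e - {v})))"
  let ?w = "\<lambda>e. \<Sum>v\<in>e. 1 / ?d e v"
  have pos: "0 < ?d e v" if "e \<in> E" "v \<in> e" for e v
  proof -
    have "v \<in> link E (e - {v})" using that by (simp add: link_def insert_absorb)
    then show ?thesis using finite_link[OF E(1) fin] by (auto simp: card_gt_0_iff)
  qed
  \<comment> \<open>These are the good edges; a bad edge has \<open>1 \<le> \<beta> * ?w e\<close>,
    so the total weight bounds the number of bad edges.\<close>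
  define H where "H = {e \<in> E. \<beta> * ?w e < 1}"
  have HE: "H \<subseteq> E" by (auto simp: H_def)
  have "real (card (E - H)) = (\<Sum>e\<in>E - H. 1)" by simp
  also have "\<dots> \<le> (\<Sum>e\<in>E - H. \<beta> * ?w e)" by (rule sum_mono) (auto simp: H_def)
  also have "\<dots> \<le> (\<Sum>e\<in>E. \<beta> * ?w e)"
    using E(1) \<open>0 \<le> \<beta>\<close> by (intro sum_mono2) (auto intro!: mult_nonneg_nonneg sum_nonneg)
  also have "\<dots> = \<beta> * real (card (shadow E))"
    using sum_inverse_codegree[OF E(1) fin] by (simp add: sum_distrib_left[symmetric])
  finally have "real (card (E - H)) \<le> \<beta> * real (card (shadow E))" .
  moreover have "card E = card H + card (E - H)"
    using HE E(1) by (metis card_Diff_subset card_mono finite_subset le_add_diff_inverse)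
  ultimately have "real (r ^ r * k) * real (card (shadow E)) < real (card H)"
    using big by (simp add: algebra_simps)
  then have bigH: "r ^ r * k * card (shadow E) < card H"
    by (metis of_nat_less_iff of_nat_mult)
  have "\<forall>e\<in>H. \<exists>\<pi>. bij_betw \<pi> e {..<r} \<and> (\<forall>v\<in>e. (real (\<pi> v) + 1) * \<beta> < ?d e v)"
  proof
    fix e assume e: "e \<in> H"
    then show "\<exists>\<pi>. bij_betw \<pi> e {..<r} \<and> (\<forall>v\<in>e. (real (\<pi> v) + 1) * \<beta> < ?d e v)"
      using rank_labelling[of e "?d e" \<beta>] pos fin E(2) \<open>0 \<le> \<beta>\<close> by (auto simp: H_def)
  qed
  then obtain \<pi> where \<pi>: "\<forall>e\<in>H. bij_betw (\<pi> e) e {..<r} \<and> (\<forall>v\<in>e. (real (\<pi> e v) + 1) * \<beta> < ?d e v)"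
    by metis
  have "finite (\<Union>E)" using E(1) fin by auto
  moreover have "\<forall>e\<in>H. e \<subseteq> \<Union>E \<and> card e = r \<and> \<pi> e ` e \<subseteq> {..<r}"
    using HE E(2) \<pi> by (auto simp: bij_betw_def)
  ultimately obtain \<chi> where \<chi>: "card H \<le> r ^ r * card {e \<in> H. \<forall>v\<in>e. \<chi> v = \<pi> e v}"
    using colouring_average[of "\<Union>E" H r \<pi>] by blast
  define H' where "H' = {e \<in> H. \<forall>v\<in>e. \<chi> v = \<pi> e v}"
  have H'E: "H' \<subseteq> E" using HE by (auto simp: H'_def)
  have "card (shadow H') \<le> card (shadow E)"
    using shadow_mono[OF H'E] finite_shadow[OF E(1) fin] by (rule card_mono[rotated])
  then have "r ^ r * (k * card (shadow H')) \<le> r ^ r * (k * card (shadow E))" by simp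
  also have "\<dots> < card H" using bigH by (simp only: mult.assoc)
  also have "\<dots> \<le> r ^ r * card H'" using \<chi> unfolding H'_def .
  finally have "k * card (shadow H') < card H'" by simp
  then obtain E' where E': "E' \<subseteq> H'" "E' \<noteq> {}" "\<forall>f\<in>shadow E'. k < card (link E' f)"
    using min_codegree_subgraph[of H' k] H'E E(1) fin by (meson finite_subset subsetD)
  have "bij_betw \<chi> e {..<r} \<and> (\<forall>v\<in>e. (real (\<chi> v) + 1) * \<beta> < ?d e v)" if "e \<in> E'" for e
  proof -
    have e: "e \<in> H" "\<forall>v\<in>e. \<chi> v = \<pi> e v" using that E'(1) by (auto simp: H'_def)
    then have "bij_betw \<chi> e {..<r}" using \<pi> by (subst bij_betw_cong[of _ _ "\<pi> e"]) auto
    then show ?thesis using e \<pi> by auto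
  qed
  moreover have "E' \<subseteq> E" using E'(1) H'E by (rule subset_trans)
  ultimately show ?thesis using E'(2,3) by (intro exI[of _ E'] exI[of _ \<chi>]) auto
qed

section \<open>A colouring of the tree adapted to its pendant vertices\<close>

text \<open>Permuting the colours keeps every edge rainbow, so the colours can be ordered by the
  number of elements of \<open>P\<close> whose vertex \<open>\<nu> p\<close> has that
  colour.\<close>

lemma tight_ordering_sorted_colouring:
  assumes "tight_ordering es" "\<forall>e\<in>set es. card e = r" "0 < r"
    and P: "P \<subseteq> set es" "\<forall>p\<in>P. \<nu> p \<in> p"
  shows "\<exists>\<kappa>. (\<forall>e\<in>set es. bij_betw \<kappa> e {..<r}) \<and>
    (\<forall>p\<in>P. r * card {q \<in> P. \<kappa> (\<nu> q) \<le> \<kappa> (\<nu> p)} \<le> (\<kappa> (\<nu> p) + 1) * card P)"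
proof -
  obtain \<kappa> where \<kappa>: "\<forall>e\<in>set es. bij_betw \<kappa> e {..<r}"
    using tight_ordering_colouring assms(1-3) by blast
  have finP: "finite P" using P(1) finite_subset by blast
  define a where "a i = card {q \<in> P. \<kappa> (\<nu> q) = i}" for i
  obtain \<sigma> where \<sigma>: "bij_betw \<sigma> {..<r} {..<r}" and
    sort: "\<forall>i<r. r * (\<Sum>j | j < r \<and> \<sigma> j \<le> \<sigma> i. a j) \<le> (\<sigma> i + 1) * sum a {..<r}"
    using sorted_relabelling[of "{..<r}" a] by auto
  have col: "\<kappa> (\<nu> p) < r" if "p \<in> P" for p
    using \<kappa> P that by (meson bij_betwE lessThan_iff subsetD)
  have total: "(\<Sum>j\<in>J. a j) = card {q \<in> P. \<kappa> (\<nu> q) \<in> J}" if "finite J" for J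
  proof -
    have "(\<Sum>j\<in>J. a j) = (\<Sum>j\<in>J. card {q \<in> {q \<in> P. \<kappa> (\<nu> q) \<in> J}. \<kappa> (\<nu> q) = j})"
      unfolding a_def by (intro sum.cong arg_cong[where f = card]) auto
    also have "\<dots> = card {q \<in> P. \<kappa> (\<nu> q) \<in> J}"
      using sum.group[of "{q \<in> P. \<kappa> (\<nu> q) \<in> J}" J "\<lambda>q. \<kappa> (\<nu> q)" "\<lambda>_. 1::nat"] finP that
      by (auto simp: card_eq_sum simp del: sum_constant)
    finally show ?thesis .
  qed
  have "r * card {q \<in> P. \<sigma> (\<kappa> (\<nu> q)) \<le> \<sigma> (\<kappa> (\<nu> p))} \<le> (\<sigma> (\<kappa> (\<nu> p)) + 1) * card P"
    if p: "p \<in> P" for p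
  proof -
    have "{q \<in> P. \<kappa> (\<nu> q) \<in> {j. j < r \<and> \<sigma> j \<le> \<sigma> (\<kappa> (\<nu> p))}} = {q \<in> P. \<sigma> (\<kappa> (\<nu> q)) \<le> \<sigma> (\<kappa> (\<nu> p))}"
      "{q \<in> P. \<kappa> (\<nu> q) \<in> {..<r}} = P"
      using col by auto
    then show ?thesis
      using sort col[OF p] total[of "{j. j < r \<and> \<sigma> j \<le> \<sigma> (\<kappa> (\<nu> p))}"] total[of "{..<r}"] by auto
  qed
  moreover have "\<forall>e\<in>set es. bij_betw (\<sigma> \<circ> \<kappa>) e {..<r}"
    using \<kappa> \<sigma> bij_betw_trans by blast
  ultimately show ?thesis by (intro exI[of _ "\<sigma> \<circ> \<kappa>"]) auto
qed

section \<open>Embedding the whole tree\<close>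

lemma inj_on_disjoint_UnI:
  "inj_on f A \<Longrightarrow> inj_on f B \<Longrightarrow> f ` A \<inter> f ` B = {} \<Longrightarrow> inj_on f (A \<union> B)"
  unfolding inj_on_def by blast

text \<open>The trunk goes into \<open>E'\<close>, after which every pendant edge has all but one
  vertex placed. The missing vertices are distinct representatives of links in \<open>E\<close> with
  the trunk image removed, chosen with the colour as key.\<close>

lemma tight_tree_embedding:
  fixes E :: "'b set set" and es fs :: "'a set list"
  assumes E: "finite E" "\<forall>e\<in>E. card e = r" and r: "0 < r"
    and T: "tight_ordering (es @ fs)" "es \<noteq> []" "\<forall>e\<in>set (es @ fs). card e = r"
    and near: "\<forall>p\<in>set fs. \<exists>e\<in>set es. card (p \<inter> e) = r - 1"
    and big: "(real (length fs) / real r + (real (length es) - 1) + real r ^ r * (real (length es) - 1))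
      * real (card (shadow E)) < real (card E)"
  shows "\<exists>F. inj_on F (\<Union>(set (es @ fs))) \<and> (\<forall>e\<in>set (es @ fs). F ` e \<in> E)"
proof -
  define k where "k = length es - 1"
  have k: "length es = k + 1" using T(2) by (cases es) (auto simp: k_def)
  define \<beta> where "\<beta> = real (length fs) / real r + real k"
  have finE: "\<forall>e\<in>E. finite e" using E(2) r by (auto intro: card_ge_0_finite)
  obtain E' \<chi> where E': "E' \<subseteq> E" "E' \<noteq> {}" "\<forall>f\<in>shadow E'. k < card (link E' f)"
    and \<chi>: "\<forall>e\<in>E'. bij_betw \<chi> e {..<r}"
    and rank: "\<forall>e\<in>E'. \<forall>v\<in>e. (real (\<chi> v) + 1) * \<beta> < real (card (link E (e - {v})))"
    proof -
    have "(\<beta> + real (r ^ r * k)) * real (card (shadow E)) < real (card E)" "0 \<le> \<beta>"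
      using big by (auto simp: \<beta>_def k)
    then obtain E' \<chi> where "E' \<subseteq> E" "E' \<noteq> {}" "\<forall>f\<in>shadow E'. k < card (link E' f)"
      "\<forall>e\<in>E'. bij_betw \<chi> e {..<r} \<and> (\<forall>v\<in>e. (real (\<chi> v) + 1) * \<beta> < real (card (link E (e - {v}))))"
      using rank_coloured_subgraph[OF E r, of \<beta> k] by metis
    then show thesis using that[of E' \<chi>] by simp
  qed
  obtain \<nu> where \<nu>: "inj_on \<nu> (set fs)" "\<forall>p\<in>set fs. \<nu> p \<in> p \<and> \<nu> p \<notin> \<Union>(set es)"
    using tight_ordering_new_vertices[OF T(1,2)] by blast
  obtain \<kappa> where \<kappa>: "\<forall>e\<in>set (es @ fs). bij_betw \<kappa> e {..<r}" and
    sort: "\<forall>p\<in>set fs. r * card {q \<in> set fs. \<kappa> (\<nu> q) \<le> \<kappa> (\<nu> p)} \<le> (\<kappa> (\<nu> p) + 1) * card (set fs)"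
    using tight_ordering_sorted_colouring[OF T(1,3) r, of "set fs" \<nu>] \<nu> by auto
  have T': "tight_ordering es" using T(1) by (rule tight_ordering_appendD)
  let ?U = "\<Union>(set es)"
  have U: "finite ?U" "card ?U \<le> k + r"
    using card_Union_tight_ordering[OF T' _ r T(2)] T(3) k by auto
  have "finite E'" using E'(1) E(1) finite_subset by blast
  then obtain g where g: "inj_on g ?U" "\<forall>e\<in>set es. g ` e \<in> E'" "\<forall>x\<in>?U. \<chi> (g x) = \<kappa> x"
    using coloured_trunk_embedding[OF T' _ r T(2), of \<kappa> E' \<chi>] \<kappa> E' \<chi> k by (auto simp: Suc_le_eq)
  let ?f = "\<lambda>p. g ` (p - {\<nu> p})"
  \<comment> \<open>A pendant edge arises from a trunk edge \<open>e\<close> by exchanging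
    \<open>x\<close> for \<open>\<nu> p\<close>. Both edges are rainbow, so the two vertices share a
    colour, and the rank inequality at \<open>g x\<close> bounds the codegree of
    \<open>?f p\<close>.\<close>
  have base: "\<exists>e\<in>set es. \<exists>x\<in>e. p - {\<nu> p} = e - {x} \<and> \<kappa> x = \<kappa> (\<nu> p)" if p: "p \<in> set fs" for p
  proof -
    obtain e where e: "e \<in> set es" "card (p \<inter> e) = r - 1" using near p by blast
    have fin: "finite p" "card p = r" "finite e" "card e = r"
      using T(3) e p r by (auto intro: card_ge_0_finite)
    have \<nu>p: "\<nu> p \<in> p" "\<nu> p \<notin> e" using \<nu>(2) p e(1) by auto
    then have "p \<inter> e \<subseteq> p - {\<nu> p}" "card (p - {\<nu> p}) = r - 1" using fin by auto
    then have "p \<inter> e = p - {\<nu> p}" using e(2) fin by (intro card_subset_eq) auto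
    then have sub: "p - {\<nu> p} \<subseteq> e" by auto
    then have "card (e - (p - {\<nu> p})) = 1" using fin \<nu>p r by (simp add: card_Diff_subset)
    then obtain x where x: "e - (p - {\<nu> p}) = {x}" by (auto simp: card_1_singleton_iff)
    have eq: "p - {\<nu> p} = e - {x}" and xe: "x \<in> e" using x sub by auto
    have be: "bij_betw \<kappa> e {..<r}" and bp: "bij_betw \<kappa> p {..<r}" using \<kappa> e p by auto
    have "\<kappa> ` (e - {x}) = {..<r} - {\<kappa> x}" using be xe by (auto simp: bij_betw_def inj_on_def)
    moreover have "\<kappa> ` (p - {\<nu> p}) = {..<r} - {\<kappa> (\<nu> p)}"
      using bp \<nu>p by (auto simp: bij_betw_def inj_on_def)
    moreover have "\<kappa> x \<in> {..<r}" using be xe by (auto simp: bij_betw_def)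
    ultimately have "\<kappa> x = \<kappa> (\<nu> p)" using eq by auto
    then show ?thesis using e(1) xe eq by blast
  qed
  let ?N = "\<lambda>p. link E (?f p) - g ` ?U"
  have "finite (?N p) \<and> card {q \<in> set fs. \<kappa> (\<nu> q) \<le> \<kappa> (\<nu> p)} \<le> card (?N p)" if p: "p \<in> set fs" for p
  proof -
    obtain e x where ex: "e \<in> set es" "x \<in> e" "p - {\<nu> p} = e - {x}" "\<kappa> x = \<kappa> (\<nu> p)"
      using base[OF p] by blast
    have eU: "e \<subseteq> ?U" using ex by auto
    have ge: "g ` e \<in> E'" using g(2) ex by auto
    have f: "?f p = g ` e - {g x}"
      using inj_on_image_set_diff[OF g(1), of e "{x}"] eU ex(2,3) by auto
    have "\<chi> (g x) = \<kappa> (\<nu> p)" using g(3) eU ex by auto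
    moreover have "(real (\<chi> (g x)) + 1) * \<beta> < real (card (link E (g ` e - {g x})))"
      using rank ge ex(2) by blast
    ultimately have lnk: "(real (\<kappa> (\<nu> p)) + 1) * \<beta> < real (card (link E (?f p)))"
      using f by simp
    have finl: "finite (link E (?f p))" using finite_link[OF E(1) finE] .
    have fin: "finite e" "card e = r" using T(3) ex(1) r by (auto intro: card_ge_0_finite)
    have "card (?f p) = r - 1"
    proof -
      have "card (g ` e) = r" using fin g(1) eU by (metis card_image inj_on_subset)
      then show ?thesis using f fin ex(2) by simp
    qed
    moreover have fU: "?f p \<subseteq> g ` ?U" using f eU by auto
    \<comment> \<open>Of at most \<open>k + r\<close> trunk vertices, \<open>r - 1\<close> lie in
      \<open>?f p\<close>.\<close>
    ultimately have "card (g ` ?U - ?f p) \<le> k + 1"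
      using U r card_image_le[OF U(1), of g] fin ex(3) by (simp add: card_Diff_subset)
    moreover have "card (link E (?f p)) \<le> card (?N p) + card (g ` ?U - ?f p)"
    proof -
      have "link E (?f p) \<subseteq> ?N p \<union> (g ` ?U - ?f p)" by (auto simp: link_def)
      then have "card (link E (?f p)) \<le> card (?N p \<union> (g ` ?U - ?f p))"
        using finl U(1) by (intro card_mono) auto
      then show ?thesis using card_Un_le order_trans by blast
    qed
    ultimately have "real (card (link E (?f p))) \<le> real (card (?N p)) + real k + 1" by linarith
    with lnk have 1: "(real (\<kappa> (\<nu> p)) + 1) * \<beta> < real (card (?N p)) + real k + 1" by linarith
    have "real (card {q \<in> set fs. \<kappa> (\<nu> q) \<le> \<kappa> (\<nu> p)}) \<le> (real (\<kappa> (\<nu> p)) + 1) * (real (length fs) / real r)"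
    proof -
      have "r * card {q \<in> set fs. \<kappa> (\<nu> q) \<le> \<kappa> (\<nu> p)} \<le> (\<kappa> (\<nu> p) + 1) * card (set fs)"
        using sort p by blast
      also have "\<dots> \<le> (\<kappa> (\<nu> p) + 1) * length fs" by (intro mult_left_mono card_length) simp
      finally have "real (r * card {q \<in> set fs. \<kappa> (\<nu> q) \<le> \<kappa> (\<nu> p)}) \<le> real ((\<kappa> (\<nu> p) + 1) * length fs)"
        by (simp only: of_nat_le_iff)
      then show ?thesis using r by (simp add: field_simps)
    qed
    \<comment> \<open>The summand \<open>real k\<close> of \<open>\<beta>\<close> accounts for
      \<open>k\<close> of the \<open>k + 1\<close> possibly blocked places; the strict inequality
      \<open>lnk\<close> and integrality absorb the last one.\<close>
    moreover have "real k \<le> (real (\<kappa> (\<nu> p)) + 1) * real k" by (simp add: algebra_simps)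
    ultimately have "real (card {q \<in> set fs. \<kappa> (\<nu> q) \<le> \<kappa> (\<nu> p)}) + real k \<le> (real (\<kappa> (\<nu> p)) + 1) * \<beta>"
      unfolding \<beta>_def distrib_left by linarith
    with 1 have "real (card {q \<in> set fs. \<kappa> (\<nu> q) \<le> \<kappa> (\<nu> p)}) < real (card (?N p)) + 1" by linarith
    then have "card {q \<in> set fs. \<kappa> (\<nu> q) \<le> \<kappa> (\<nu> p)} \<le> card (?N p)" by linarith
    then show ?thesis using finl by simp
  qed
  then obtain h where h: "inj_on h (set fs)" "\<forall>p\<in>set fs. h p \<in> ?N p"
    using distinct_representatives_by_key[of "set fs" ?N "\<lambda>p. \<kappa> (\<nu> p)"] by auto
  \<comment> \<open>A vertex outside the trunk is traced back through \<open>\<nu>\<close> to the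
    pendant edge that introduced it.\<close>
  define F where "F x = (if x \<in> ?U then g x else h (inv_into (set fs) \<nu> x))" for x
  have FU: "F x = g x" if "x \<in> ?U" for x using that by (simp add: F_def)
  have F\<nu>: "F (\<nu> p) = h p" if "p \<in> set fs" for p
    using that \<nu> by (auto simp: F_def inv_into_f_f)
  have subU: "p - {\<nu> p} \<subseteq> ?U" if "p \<in> set fs" for p using base[OF that] by blast
  have verts: "\<Union>(set (es @ fs)) \<subseteq> ?U \<union> \<nu> ` set fs" using subU by auto
  have "inj_on F ?U" using g(1) FU by (auto simp: inj_on_def)
  moreover have "inj_on F (\<nu> ` set fs)" using h(1) F\<nu> by (auto simp: inj_on_def)
  moreover have "F ` ?U \<inter> F ` (\<nu> ` set fs) = {}"
  proof -
    have "F ` ?U = g ` ?U" using FU by (intro image_cong) auto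
    moreover have "F (\<nu> p) \<notin> g ` ?U" if "p \<in> set fs" for p using F\<nu> h(2) that by auto
    ultimately have "F (\<nu> p) \<notin> F ` ?U" if "p \<in> set fs" for p using that by simp
    then have "F ` (\<nu> ` set fs) \<subseteq> - F ` ?U" by (intro image_subsetI) (elim imageE, simp)
    then show ?thesis by (metis disjoint_eq_subset_Compl Int_commute)
  qed
  ultimately have "inj_on F (?U \<union> \<nu> ` set fs)" by (rule inj_on_disjoint_UnI)
  then have "inj_on F (\<Union>(set (es @ fs)))" using verts inj_on_subset by blast
  moreover have "F ` e \<in> E" if "e \<in> set es" for e
  proof -
    have "F ` e = g ` e" using FU that by (intro image_cong) auto
    then show ?thesis using g(2) E'(1) that by auto
  qed
  moreover have "F ` p \<in> E" if p: "p \<in> set fs" for p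
  proof -
    have "p = insert (\<nu> p) (p - {\<nu> p})" using \<nu>(2) p by auto
    then have "F ` p = insert (F (\<nu> p)) (F ` (p - {\<nu> p}))" by (metis image_insert)
    also have "F ` (p - {\<nu> p}) = ?f p"
      using FU subsetD[OF subU[OF p]] by (intro image_cong) blast+
    finally show ?thesis using F\<nu> h(2) p by (auto simp: link_def)
  qed
  ultimately have "inj_on F (\<Union>(set (es @ fs))) \<and> (\<forall>e\<in>set (es @ fs). F ` e \<in> E)"
    by (simp only: set_append Un_iff ball_Un) blast
  then show ?thesis by blast
qed

section \<open>The bound on the extremal number\<close>

lemma card_shadow_le:
  assumes "finite V" "\<forall>e\<in>E. e \<subseteq> V \<and> card e = r"
  shows "card (shadow E) \<le> card V choose (r - 1)"
proof -
  have "shadow E \<subseteq> {f. f \<subseteq> V \<and> card f = r - 1}"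
    using assms by (auto simp: shadow_def card_Diff_singleton_if dest: finite_subset)
  then have "card (shadow E) \<le> card {f. f \<subseteq> V \<and> card f = r - 1}"
    using assms(1) by (intro card_mono) (auto intro: finite_subset[of _ "Pow V"])
  then show ?thesis using n_subsets[OF assms(1)] by simp
qed

text \<open>Provides the witness that makes the minimum in \<open>min_trunk_size\<close>
  attained.\<close>

lemma trunk_self:
  assumes "tight_tree r T"
  shows "trunk r T T"
proof -
  obtain es where "set es = edges T" "tight_ordering es" using assms by (auto simp: tight_tree_def)
  then have "set es = edges T \<and> set (es @ []) = edges T \<and> tight_ordering (es @ [])" by simp
  then have "\<exists>es fs. set es = edges T \<and> set (es @ fs) = edges T \<and> tight_ordering (es @ fs)" by blast
  then show ?thesis using assms by (simp add: trunk_def subgraph_def)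
qed

theorem theorem1p3:
  fixes n r t c :: nat and T :: "'a hypergraph"
  assumes "r \<le> n" and "2 \<le> r" and "1 \<le> c" and "c \<le> t"
    and "tight_tree r T" and "card (edges T) = t" and "min_trunk_size r T \<le> c"
  shows "real (ex_num r n T) \<le>
    ((real t - 1) / real r + a_const r c) * real (n choose (r - 1))"
proof -
  let ?B = "((real t - 1) / real r + a_const r c) * real (n choose (r - 1))"
  have "\<exists>T'. trunk r T' T \<and> card (edges T') = min_trunk_size r T"
    unfolding min_trunk_size_def by (rule LeastI) (use trunk_self[OF assms(5)] in blast)
  then obtain T' where T': "trunk r T' T" "card (edges T') \<le> c" using assms(7) by auto
  then obtain es fs where ef: "set es = edges T'" "set (es @ fs) = edges T" "tight_ordering (es @ fs)"
    and near: "\<forall>e\<in>edges T - edges T'. \<exists>e'\<in>edges T'. card (e \<inter> e') = r - 1"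
    and tt: "tight_tree r T'"
    unfolding trunk_def by blast
  have es: "es \<noteq> []" using tt ef(1) by (auto simp: tight_tree_def)
  have dist: "distinct (es @ fs)" using ef(3) by (simp add: tight_ordering_def)
  have lt: "length es + length fs = t" using dist ef(2) assms(6) by (metis distinct_card length_append)
  have lc: "length es \<le> c" using dist ef(1) T'(2) by (metis distinct_append distinct_card)
  have near': "\<forall>p\<in>set fs. \<exists>e\<in>set es. card (p \<inter> e) = r - 1"
    using near ef dist by auto
  have VT: "verts T = \<Union>(set (es @ fs))" and unif: "\<forall>e\<in>set (es @ fs). card e = r"
    using assms(5) ef(2) by (auto simp: tight_tree_def r_graph_def)
  let ?b = "real (length fs) / real r + (real (length es) - 1) + real r ^ r * (real (length es) - 1)"
  have les: "1 \<le> length es" using es by (cases es) auto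
  have b: "?b \<le> (real t - 1) / real r + a_const r c"
  proof -
    \<comment> \<open>Writing \<open>length fs\<close> as \<open>t - 1\<close> minus
      \<open>length es - 1\<close> produces the \<open>- 1 / real r\<close> of
      \<open>a_const\<close>. The coefficient of \<open>length es - 1\<close> is nonnegative, so
      replacing the actual trunk size by \<open>c\<close> only weakens the bound.\<close>
    have "?b = (real t - 1) / real r + (real r ^ r + 1 - 1 / real r) * (real (length es) - 1)"
      using assms(2) unfolding lt[symmetric] by (simp add: field_simps)
    also have "\<dots> \<le> (real t - 1) / real r + (real r ^ r + 1 - 1 / real r) * (real c - 1)"
    proof -
      have "1 / real r \<le> 1" "0 \<le> real r ^ r" using assms(2) by auto
      then have "0 \<le> real r ^ r + 1 - 1 / real r" by linarith
      then show ?thesis using lc by (intro add_left_mono mult_left_mono) auto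
    qed
    finally show ?thesis by (simp add: a_const_def)
  qed
  have b0: "0 \<le> ?b" using les by simp
  have bound: "real (card (edges G)) \<le> ?B"
    if G: "r_graph r G" "card (verts G) = n" "\<not> contains_copy G T" for G :: "nat hypergraph"
  proof -
    have GE: "finite (verts G)" "\<forall>e\<in>edges G. e \<subseteq> verts G \<and> card e = r"
      using G(1) by (auto simp: r_graph_def)
    then have finE: "finite (edges G)" by (meson PowI finite_Pow_iff finite_subset subsetI)
    have "\<not> (\<exists>F. inj_on F (\<Union>(set (es @ fs))) \<and> (\<forall>e\<in>set (es @ fs). F ` e \<in> edges G))"
    proof
      assume "\<exists>F. inj_on F (\<Union>(set (es @ fs))) \<and> (\<forall>e\<in>set (es @ fs). F ` e \<in> edges G)"
      then obtain F where F: "inj_on F (verts T)" "\<forall>e\<in>edges T. F ` e \<in> edges G"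
        using VT ef(2) by metis
      then have "F ` verts T \<subseteq> verts G" using VT ef(2) GE(2) by blast
      then show False using F G(3) unfolding contains_copy_def by blast
    qed
    then have "real (card (edges G)) \<le> ?b * real (card (shadow (edges G)))"
      using tight_tree_embedding[OF finE _ _ ef(3) es unif near'] GE(2) assms(2) by fastforce
    also have "\<dots> \<le> ?b * real (n choose (r - 1))"
      using card_shadow_le[OF GE] G(2) b0 by (intro mult_left_mono) auto
    also have "\<dots> \<le> ?B" using b by (rule mult_right_mono) simp
    finally show ?thesis .
  qed
  let ?M = "{card (edges G) | G :: nat hypergraph.
            r_graph r G \<and> card (verts G) = n \<and> \<not> contains_copy G T}"
  \<comment> \<open>\<open>Max\<close> is meaningful only on a finite nonempty set:
    \<open>bound\<close> gives finiteness, and the edgeless host gives a member.\<close>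
  have "?M \<subseteq> {..nat \<lfloor>?B\<rfloor>}" using bound by (auto simp: le_nat_floor)
  then have "finite ?M" using finite_subset by blast
  moreover have "?M \<noteq> {}"
  proof -
    have "\<not> contains_copy (Hypergraph {..<n} {}) T"
      using ef(2) es by (cases es) (auto simp: contains_copy_def)
    then have "card (edges (Hypergraph {..<n} {} :: nat hypergraph)) \<in> ?M"
      by (intro CollectI exI[of _ "Hypergraph {..<n} {}"]) (auto simp: r_graph_def)
    then show ?thesis by blast
  qed
  ultimately have "Max ?M \<in> ?M" by (rule Max_in)
  then show ?thesis using bound unfolding ex_num_def by auto
qed

end
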